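(* Suppose the convex loss $\rho$ is differentiable and Lipschitz continuous with constant $L$, i.e. $|\rho(x)-\rho(y)|\le L|x-y|$ for all $x,y\in\mathbb R$. Suppose the two-point-margin condition holds: there is an increasing strictly convex function $G$ on $[0,\infty)$ with $G(0)=0$ such that for all $B_1,B_2\in\mathcal B$ $$R(B_1)-R(B_2)\ \ge\ \operatorname{trace}\big(\dot R(B_2)^T(B_1-B_2)\big)+G(\|B_1-B_2\|_F).$$ Let $H$ be the convex conjugate of $G$. Let $B\in\mathcal B$, let $1\le s\le q$ be an integer, and let $B^-$, $\Omega^+$, $\Omega^-$, $\underline\Omega$ be defined from $B$ and $s$ as in the context. Assume that for some $\lambda_\varepsilon>0$ and $\lambda_*>0$ and for all $B'\in\mathcal B$ $$\Big|\operatorname{trace}\Big(\big(\dot R_n(B')-\dot R(B')\big)^T(B-B')\Big)\Big|\ \le\ \lambda_\varepsilon\,\underline\Omega(B'-B)+\lambda_*.$$ Take $\lambda>\lambda_\varepsilon$, let $0\le\delta<1$ be arbitrary, and define $\underline\lambda:=\lambda-\lambda_\varepsilon$ and $\overline\lambda:=\lambda_\varepsilon+\lambda+\delta\underline\lambda$. Let $\hat B$ be a minimizer over $\mathcal B$ of $R_n(\cdot)+\lambda\|\cdot\|_{\rm nuclear}$. Then $$\delta\underline\lambda\,\Omega^+(\hat B-B)+\delta\underline\lambda\,\Omega^-(\hat B-B)+R(\hat B)-R(B)\ \le\ H\big(3\overline\lambda\sqrt s\big)+2\lambda\|B^-\|_{\rm nuclear}+\lambda_*.$$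
   Context: Let $q\le p$, $\eta>0$ and $\mathcal B=\{B\in\mathbb R^{p\times q}:\|B\|_\infty\le\eta\}$, where $\|B\|_\infty$ is the largest absolute value of the entries. Observations $(X_i,Y_i)$, $i=1,\dots,n$, have $Y_i\in\mathbb R$ and $X_i\in\{e_k(q)e_l(p)^T:1\le k\le q,1\le l\le p\}$ ($q\times p$ matrices with one entry equal to 1 and the others 0). For a convex loss $\rho:\mathbb R\to\mathbb R$, the empirical risk is $R_n(B)=\frac1n\sum_{i=1}^n\rho(Y_i-\operatorname{trace}(X_iB))$ and the theoretical risk is $R(B)=\mathbb E R_n(B)$ (assumed finite). $\dot R_n(B')$ and $\dot R(B')$ are the $p\times q$ matrices of partial derivatives with respect to the entries of $B$, evaluated at $B'$. $\|\cdot\|_F$ is the Frobenius norm and $\|\cdot\|_{\rm nuclear}$ the sum of singular values. Convex conjugate: $H(v)=\sup_{u\ge0}\{uv-G(u)\}$ for $v\ge0$. Given $B$, write its singular value decomposition $B=P\Lambda Q^T$ with $P\in\mathbb R^{p\times q}$, $Q\in\mathbb R^{q\times q}$ having orthonormal columns $P_k$, $Q_k$, and $\Lambda=\mathrm{diag}(\Lambda_1\ge\dots\ge\Lambda_q\ge0)$. For the integer $s$ put $B^+=\sum_{k=1}^s\Lambda_kP_kQ_k^T$, $B^-=\sum_{k=s+1}^q\Lambda_kP_kQ_k^T$, $P^+=(P_1,\dots,P_s)$, $Q^+=(Q_1,\dots,Q_s)$. For $A\in\mathbb R^{p\times q}$ define $$\Omega^+(A)=\sqrt s\big(\|P^+P^{+T}A\|_F+\|AQ^+Q^{+T}\|_F+\|P^+P^{+T}AQ^+Q^{+T}\|_F\big),$$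 $$\Omega^-(A)=\|(I-P^+P^{+T})A(I-Q^+Q^{+T})\|_{\rm nuclear},\qquad \underline\Omega=\Omega^++\Omega^-.$$ *)

theory Defs
  imports "HOL-Probability.Probability"
begin

text \<open>
  A real matrix with \<open>p\<close> rows and \<open>q\<close> columns is an element of \<^typ>\<open>real^'q^'p\<close>, with
  \<open>p = CARD('p)\<close> and \<open>q = CARD('q)\<close>. On this type the library norm is the Frobenius norm and
  \<^const>\<open>infnorm\<close> is the largest absolute value of the entries; see \<open>norm_matrix_eq_Frobenius\<close> and
  \<open>infnorm_matrix_le_iff\<close> below.
\<close>

definition outer :: "real^'m \<Rightarrow> real^'n \<Rightarrow> real^'n^'m" where
  "outer u v = (\<chi> i j. u $ i * v $ j)"


subsection \<open>Singular values\<close>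

text \<open>
  The columns of the factors of a singular value decomposition are families indexed by the numbers
  \<open>1, \<dots>, q\<close>, since the column index type \<open>'q\<close> carries no order.
\<close>

definition orthonormal_family :: "nat set \<Rightarrow> (nat \<Rightarrow> 'a::real_inner) \<Rightarrow> bool" where
  "orthonormal_family I u \<longleftrightarrow> (\<forall>j\<in>I. \<forall>k\<in>I. u j \<bullet> u k = (if j = k then 1 else 0))"

definition is_svd ::
    "real^'q^'p \<Rightarrow> (nat \<Rightarrow> real^'p) \<Rightarrow> (nat \<Rightarrow> real) \<Rightarrow> (nat \<Rightarrow> real^'q) \<Rightarrow> bool" where
  "is_svd B P \<Lambda> Q \<longleftrightarrow>
     orthonormal_family {1..CARD('q)} P \<and>
     orthonormal_family {1..CARD('q)} Q \<and>
     antimono_on {1..CARD('q)} \<Lambda> \<and>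
     (\<forall>k\<in>{1..CARD('q)}. 0 \<le> \<Lambda> k) \<and>
     B = (\<Sum>k=1..CARD('q). \<Lambda> k *\<^sub>R outer (P k) (Q k))"

definition singular_space :: "real^'q^'p \<Rightarrow> real \<Rightarrow> (real^'q) set" where
  "singular_space A \<sigma> = {v. (transpose A ** A) *v v = \<sigma>\<^sup>2 *\<^sub>R v}"

text \<open>
  The singular values are the square roots of the eigenvalues of \<open>A\<^sup>T A\<close>, each counted with the
  dimension of its eigenspace. By \<open>nuclear_norm_svd\<close> below, their sum is \<open>\<Lambda>\<^sub>1 + \<dots> + \<Lambda>\<^sub>q\<close> for every
  singular value decomposition.
\<close>

definition nuclear_norm :: "real^'q^'p \<Rightarrow> real" where
  "nuclear_norm A =
     (\<Sum>\<sigma> | 0 \<le> \<sigma> \<and> singular_space A \<sigma> \<noteq> {0}. real (dim (singular_space A \<sigma>)) * \<sigma>)"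


subsection \<open>The seminorms given by a singular value decomposition\<close>

text \<open>\<^term>\<open>proj_first s u\<close> is \<open>U U\<^sup>T\<close>, where \<open>U\<close> has the columns \<open>u\<^sub>1, \<dots>, u\<^sub>s\<close>.\<close>

definition proj_first :: "nat \<Rightarrow> (nat \<Rightarrow> real^'n) \<Rightarrow> real^'n^'n" where
  "proj_first s u = (\<Sum>k=1..s. outer (u k) (u k))"

definition B_minus ::
    "nat \<Rightarrow> (nat \<Rightarrow> real^'p) \<Rightarrow> (nat \<Rightarrow> real) \<Rightarrow> (nat \<Rightarrow> real^'q) \<Rightarrow> real^'q^'p" where
  "B_minus s P \<Lambda> Q = (\<Sum>k=s+1..CARD('q). \<Lambda> k *\<^sub>R outer (P k) (Q k))"

definition Omega_plus ::
    "nat \<Rightarrow> (nat \<Rightarrow> real^'p) \<Rightarrow> (nat \<Rightarrow> real^'q) \<Rightarrow> real^'q^'p \<Rightarrow> real" where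
  "Omega_plus s P Q A =
     sqrt (real s) *
       (norm (proj_first s P ** A) + norm (A ** proj_first s Q)
        + norm (proj_first s P ** A ** proj_first s Q))"

definition Omega_minus ::
    "nat \<Rightarrow> (nat \<Rightarrow> real^'p) \<Rightarrow> (nat \<Rightarrow> real^'q) \<Rightarrow> real^'q^'p \<Rightarrow> real" where
  "Omega_minus s P Q A =
     nuclear_norm ((mat 1 - proj_first s P) ** A ** (mat 1 - proj_first s Q))"

definition Omega_under ::
    "nat \<Rightarrow> (nat \<Rightarrow> real^'p) \<Rightarrow> (nat \<Rightarrow> real^'q) \<Rightarrow> real^'q^'p \<Rightarrow> real" where
  "Omega_under s P Q A = Omega_plus s P Q A + Omega_minus s P Q A"


subsection \<open>Risks\<close>

definition param_set :: "real \<Rightarrow> (real^'q^'p) set" where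
  "param_set \<eta> = {B. infnorm B \<le> \<eta>}"

definition design_set :: "(real^'p^'q) set" where
  "design_set = {outer (axis k 1) (axis l 1) | k l. True}"

definition emp_risk ::
    "(real \<Rightarrow> real) \<Rightarrow> nat \<Rightarrow> (nat \<Rightarrow> real^'p^'q) \<Rightarrow> (nat \<Rightarrow> real) \<Rightarrow> real^'q^'p \<Rightarrow> real" where
  "emp_risk \<rho> n x y B = 1 / real n * (\<Sum>i=1..n. \<rho> (y i - trace (x i ** B)))"

definition risk ::
    "'w measure \<Rightarrow> (real \<Rightarrow> real) \<Rightarrow> nat \<Rightarrow> (nat \<Rightarrow> 'w \<Rightarrow> real^'p^'q) \<Rightarrow> (nat \<Rightarrow> 'w \<Rightarrow> real)
      \<Rightarrow> real^'q^'p \<Rightarrow> real" where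
  "risk M \<rho> n X Y B = (\<integral>\<omega>. emp_risk \<rho> n (\<lambda>i. X i \<omega>) (\<lambda>i. Y i \<omega>) B \<partial>M)"

definition partials :: "(real^'q^'p \<Rightarrow> real) \<Rightarrow> real^'q^'p \<Rightarrow> real^'q^'p" where
  "partials f B = (\<chi> i j. deriv (\<lambda>t. f (B + t *\<^sub>R axis i (axis j 1))) 0)"


subsection \<open>Margin functions and conjugates\<close>

definition strictly_convex_on :: "real set \<Rightarrow> (real \<Rightarrow> real) \<Rightarrow> bool" where
  "strictly_convex_on S f \<longleftrightarrow> convex S \<and>
     (\<forall>x\<in>S. \<forall>y\<in>S. \<forall>t. x \<noteq> y \<longrightarrow> 0 < t \<longrightarrow> t < 1 \<longrightarrow>
        f ((1 - t) * x + t * y) < (1 - t) * f x + t * f y)"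

text \<open>
  The conjugate is extended-real-valued: if \<open>G\<close> grows only linearly, the supremum is infinite for
  large \<open>v\<close>.
\<close>

definition convex_conjugate :: "(real \<Rightarrow> real) \<Rightarrow> real \<Rightarrow> ereal" where
  "convex_conjugate G v = (SUP u\<in>{0..}. ereal (u * v - G u))"


subsection \<open>Agreement with the entrywise and spectral descriptions\<close>

lemma norm_matrix_eq_Frobenius:
  fixes A :: "real^'q^'p"
  shows "norm A = sqrt (\<Sum>i\<in>UNIV. \<Sum>j\<in>UNIV. (A $ i $ j)\<^sup>2)"
  by (simp add: norm_vec_def L2_set_def sum_nonneg)

lemma infnorm_matrix_le_iff:
  fixes A :: "real^'q^'p"
  shows "infnorm A \<le> \<eta> \<longleftrightarrow> (\<forall>i j. \<bar>A $ i $ j\<bar> \<le> \<eta>)"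
proof -
  have B: "(Basis :: (real^'q^'p) set) = {axis i (axis j 1) | i j. True}"
    by (auto simp: Basis_vec_def)
  have "{\<bar>A \<bullet> b\<bar> |b. b \<in> Basis} = {\<bar>A $ i $ j\<bar> | i j. True}"
  proof -
    have e: "A \<bullet> axis i (axis j 1) = A $ i $ j" for i j
      by (simp add: inner_axis)
    show ?thesis
      unfolding B by (auto simp: e) (metis e)+
  qed
  moreover have "finite {\<bar>A \<bullet> b\<bar> |b. b \<in> Basis}"
    by (simp add: setcompr_eq_image)
  ultimately show ?thesis
    unfolding infnorm_def by (subst cSup_le_iff) (auto intro: bdd_above_finite)
qed

lemma orthonormal_family_independent:
  fixes u :: "nat \<Rightarrow> 'a::euclidean_space"
  assumes "orthonormal_family I u" "J \<subseteq> I" "finite J"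
  shows "inj_on u J" "independent (u ` J)" "dim (u ` J) = card J"
proof -
  have o: "u j \<bullet> u k = (if j = k then 1 else 0)" if "j \<in> J" "k \<in> J" for j k
    using assms that unfolding orthonormal_family_def by blast
  show inj: "inj_on u J"
    by (rule inj_onI) (metis o zero_neq_one)
  have "pairwise orthogonal (u ` J)"
    unfolding pairwise_def orthogonal_def using o by auto
  moreover have "0 \<notin> u ` J"
    using o by (metis imageE inner_zero_left zero_neq_one)
  ultimately show ind: "independent (u ` J)"
    by (rule pairwise_orthogonal_independent)
  show "dim (u ` J) = card J"
    using dim_eq_card_independent[OF ind] card_image[OF inj] by simp
qed

lemma outer_mult_vec: "outer u v *v x = (v \<bullet> x) *\<^sub>R u"
  by (simp add: vec_eq_iff outer_def matrix_vector_mult_def inner_vec_def sum_distrib_left sum_distrib_right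
      mult_ac)

lemma sum_matrix_vec:
  fixes A :: "'i \<Rightarrow> real^'n^'m"
  shows "(\<Sum>k\<in>I. A k) *v x = (\<Sum>k\<in>I. A k *v x)"
  by (induction I rule: infinite_finite_induct) (auto simp: matrix_vector_mult_add_rdistrib)

lemma nuclear_norm_svd:
  fixes A :: "real^'q^'p"
  assumes "is_svd A P \<Lambda> Q"
  shows "nuclear_norm A = (\<Sum>k=1..CARD('q). \<Lambda> k)"
proof -
  let ?I = "{1..CARD('q)}"
  have oP: "orthonormal_family ?I P" and oQ: "orthonormal_family ?I Q"
    and nn: "\<And>k. k \<in> ?I \<Longrightarrow> 0 \<le> \<Lambda> k" and A: "A = (\<Sum>k\<in>?I. \<Lambda> k *\<^sub>R outer (P k) (Q k))"
    using assms unfolding is_svd_def by auto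
  have QQ: "Q j \<bullet> Q k = (if j = k then 1 else 0)" if "j \<in> ?I" "k \<in> ?I" for j k
    using oQ that unfolding orthonormal_family_def by blast
  have PP: "P j \<bullet> P k = (if j = k then 1 else 0)" if "j \<in> ?I" "k \<in> ?I" for j k
    using oP that unfolding orthonormal_family_def by blast
  note Qi = orthonormal_family_independent[OF oQ subset_refl finite_atLeastAtMost]
  have spanQ: "span (Q ` ?I) = UNIV"
    using Qi by (intro dim_eq_full[THEN iffD1]) simp
  have ext: "v = w" if "\<And>k. k \<in> ?I \<Longrightarrow> Q k \<bullet> v = Q k \<bullet> w" for v w
  proof -
    have "orthogonal (v - w) y" if "y \<in> Q ` ?I" for y
      using that \<open>\<And>k. k \<in> ?I \<Longrightarrow> Q k \<bullet> v = Q k \<bullet> w\<close>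
      by (auto simp only: orthogonal_def inner_diff_left inner_commute[of _ "Q _"] diff_self)
    moreover have "v - w \<in> span (Q ` ?I)"
      by (simp only: spanQ UNIV_I)
    ultimately have "orthogonal (v - w) (v - w)"
      by (rule orthogonal_to_span[rotated])
    then show ?thesis
      by (simp only: orthogonal_self right_minus_eq)
  qed
  have AQ: "A *v Q k = \<Lambda> k *\<^sub>R P k" if "k \<in> ?I" for k
  proof -
    have "A *v Q k = (\<Sum>j\<in>?I. (\<Lambda> j * (Q j \<bullet> Q k)) *\<^sub>R P j)"
      unfolding A sum_matrix_vec
      by (intro sum.cong) (auto simp: scaleR_matrix_vector_assoc[symmetric] outer_mult_vec)
    also have "\<dots> = (\<Sum>j\<in>?I. if j = k then \<Lambda> k *\<^sub>R P k else 0)"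
      using that by (intro sum.cong) (auto simp: QQ)
    finally show ?thesis using that by simp
  qed
  have PA: "P k \<bullet> (A *v v) = \<Lambda> k * (Q k \<bullet> v)" if "k \<in> ?I" for k v
  proof -
    have "P k \<bullet> (A *v v) = (\<Sum>j\<in>?I. \<Lambda> j * (Q j \<bullet> v) * (P k \<bullet> P j))"
      unfolding A sum_matrix_vec inner_sum_right
      by (intro sum.cong)
        (auto simp: scaleR_matrix_vector_assoc[symmetric] outer_mult_vec mult_ac)
    also have "\<dots> = (\<Sum>j\<in>?I. if j = k then \<Lambda> k * (Q k \<bullet> v) else 0)"
      using that by (intro sum.cong) (auto simp: PP)
    finally show ?thesis using that by simp
  qed
  have gram: "Q k \<bullet> ((transpose A ** A) *v v) = (\<Lambda> k)\<^sup>2 * (Q k \<bullet> v)" if "k \<in> ?I" for k v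
  proof -
    have "Q k \<bullet> ((transpose A ** A) *v v) = (A *v Q k) \<bullet> (A *v v)"
      by (simp only: matrix_vector_mul_assoc[symmetric] dot_lmul_matrix[symmetric]
          vector_transpose_matrix)
    then show ?thesis
      using that by (simp add: AQ PA power2_eq_square)
  qed
  have space: "singular_space A \<sigma> = span (Q ` {k\<in>?I. \<Lambda> k = \<sigma>})" if "0 \<le> \<sigma>" for \<sigma>
  proof -
    let ?J = "{k\<in>?I. \<Lambda> k = \<sigma>}"
    have sq: "(\<Lambda> k)\<^sup>2 = \<sigma>\<^sup>2 \<longleftrightarrow> \<Lambda> k = \<sigma>" if "k \<in> ?I" for k
      using nn[OF that] \<open>0 \<le> \<sigma>\<close> by (simp add: power2_eq_iff_nonneg)
    have mem: "v \<in> singular_space A \<sigma> \<longleftrightarrow> (\<forall>k\<in>?I. \<Lambda> k \<noteq> \<sigma> \<longrightarrow> Q k \<bullet> v = 0)" for v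
    proof -
      have "v \<in> singular_space A \<sigma> \<longleftrightarrow>
          (\<forall>k\<in>?I. Q k \<bullet> ((transpose A ** A) *v v) = Q k \<bullet> (\<sigma>\<^sup>2 *\<^sub>R v))"
        unfolding singular_space_def using ext by auto
      also have "\<dots> \<longleftrightarrow> (\<forall>k\<in>?I. \<Lambda> k \<noteq> \<sigma> \<longrightarrow> Q k \<bullet> v = 0)"
        by (intro ball_cong refl) (auto simp: gram sq)
      finally show ?thesis .
    qed
    show ?thesis
    proof (intro subset_antisym subsetI)
      fix v assume v: "v \<in> singular_space A \<sigma>"
      have "v = (\<Sum>k\<in>?J. (Q k \<bullet> v) *\<^sub>R Q k)"
      proof (rule ext)
        fix k assume k: "k \<in> ?I"
        have "Q k \<bullet> (\<Sum>j\<in>?J. (Q j \<bullet> v) *\<^sub>R Q j)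
            = (\<Sum>j\<in>?J. if j = k then Q k \<bullet> v else 0)"
          unfolding inner_sum_right using k by (intro sum.cong) (auto simp: QQ)
        also have "\<dots> = Q k \<bullet> v"
          using v k unfolding mem by auto
        finally show "Q k \<bullet> v = Q k \<bullet> (\<Sum>j\<in>?J. (Q j \<bullet> v) *\<^sub>R Q j)" by simp
      qed
      also have "\<dots> \<in> span (Q ` ?J)"
        by (intro span_sum span_scale span_base) auto
      finally show "v \<in> span (Q ` ?J)" .
    next
      fix v assume v: "v \<in> span (Q ` ?J)"
      have "orthogonal (Q k) v" if "k \<in> ?I" "\<Lambda> k \<noteq> \<sigma>" for k
        using v that by (intro orthogonal_to_span[of v "Q ` ?J"]) (auto simp: orthogonal_def QQ)
      then show "v \<in> singular_space A \<sigma>"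
        unfolding mem by (auto simp: orthogonal_def)
    qed
  qed
  have dim: "dim (singular_space A \<sigma>) = card {k\<in>?I. \<Lambda> k = \<sigma>}" if "0 \<le> \<sigma>" for \<sigma>
    unfolding space[OF that] dim_span
    by (rule orthonormal_family_independent(3)[OF oQ]) auto
  have "{\<sigma>. 0 \<le> \<sigma> \<and> singular_space A \<sigma> \<noteq> {0}} = \<Lambda> ` ?I"
  proof (intro subset_antisym subsetI)
    fix \<sigma> assume "\<sigma> \<in> {\<sigma>. 0 \<le> \<sigma> \<and> singular_space A \<sigma> \<noteq> {0}}"
    then have "0 \<le> \<sigma>" and ne: "singular_space A \<sigma> \<noteq> {0}" by auto
    show "\<sigma> \<in> \<Lambda> ` ?I"
    proof (rule ccontr)
      assume "\<sigma> \<notin> \<Lambda> ` ?I"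
      then have "{k\<in>?I. \<Lambda> k = \<sigma>} = {}" by auto
      then have "singular_space A \<sigma> = {0}"
        by (simp only: space[OF \<open>0 \<le> \<sigma>\<close>] image_empty span_empty)
      with ne show False by contradiction
    qed
  next
    fix \<sigma> assume "\<sigma> \<in> \<Lambda> ` ?I"
    then obtain k where k: "k \<in> ?I" "\<sigma> = \<Lambda> k" by auto
    then have "0 \<le> \<sigma>" using nn by simp
    have "Q k \<in> singular_space A \<sigma>"
      unfolding space[OF \<open>0 \<le> \<sigma>\<close>] using k by (intro span_base) auto
    moreover have "Q k \<noteq> 0"
      using QQ[OF k(1) k(1)] by auto
    ultimately show "\<sigma> \<in> {\<sigma>. 0 \<le> \<sigma> \<and> singular_space A \<sigma> \<noteq> {0}}"
      using \<open>0 \<le> \<sigma>\<close> by blast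
  qed
  then have "nuclear_norm A = (\<Sum>\<sigma>\<in>\<Lambda> ` ?I. real (card {k\<in>?I. \<Lambda> k = \<sigma>}) * \<sigma>)"
    unfolding nuclear_norm_def using nn by (intro sum.cong) (auto simp: dim)
  also have "\<dots> = (\<Sum>\<sigma>\<in>\<Lambda> ` ?I. \<Sum>k | k \<in> ?I \<and> \<Lambda> k = \<sigma>. \<Lambda> k)"
    by (intro sum.cong) auto
  also have "\<dots> = (\<Sum>k\<in>?I. \<Lambda> k)"
    by (intro sum.image_gen[symmetric]) simp
  finally show ?thesis .
qed

end

theory Submission
  imports Defs
begin

text \<open>
  The nuclear norm is the maximum of \<open>\<langle>A, W\<rangle>\<close> over contractions \<open>W\<close>, by the singular value
  decomposition. Testing \<open>B + D\<close> against one contraction adapted to the leading singular vectors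
  of \<open>B\<close> and to the part of \<open>D\<close> orthogonal to them gives
  \<open>\<parallel>B\<parallel> - \<parallel>B + D\<parallel> \<le> \<Omega>\<^sup>+(D) - \<Omega>\<^sup>-(D) + 2 \<parallel>B\<^sup>-\<parallel>\<close>. With \<open>D\<close> the estimation error, this is combined
  with the first-order optimality condition for the minimizer, the margin condition and the noise
  bound. What remains of \<open>\<Omega>\<^sup>+(D)\<close> is at most \<open>3 \<surd>s\<close> times the Frobenius norm of \<open>D\<close>, and the
  Fenchel-Young inequality trades it against \<open>G\<close>.
\<close>

subsection \<open>Matrices and orthonormal families\<close>

text \<open>Turns the trace pairings of the margin and noise conditions into inner products, where
  adjoints and Cauchy-Schwarz apply.\<close>

lemma inner_matrix_trace:
  fixes A W :: "real^'q^'p"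
  shows "A \<bullet> W = trace (transpose A ** W)"
  unfolding trace_def transpose_def matrix_matrix_mult_def inner_vec_def
  by (simp, rule sum.swap)

lemma inner_matrix_mult_left:
  fixes A :: "real^'q^'p" and S :: "real^'p^'r"
  shows "(S ** A) \<bullet> W = A \<bullet> (transpose S ** W)"
  by (simp add: inner_matrix_trace matrix_transpose_mul matrix_mul_assoc)

lemma inner_matrix_mult_right:
  fixes A :: "real^'q^'p" and S :: "real^'r^'q"
  shows "(A ** S) \<bullet> W = A \<bullet> (W ** transpose S)"
proof -
  have "(A ** S) \<bullet> W = trace (transpose S ** (transpose A ** W))"
    by (simp add: inner_matrix_trace matrix_transpose_mul matrix_mul_assoc)
  also have "\<dots> = trace ((transpose A ** W) ** transpose S)"
    by (rule trace_mul_sym)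
  finally show ?thesis
    by (simp add: inner_matrix_trace matrix_mul_assoc)
qed

lemma inner_outer:
  fixes W :: "real^'q^'p"
  shows "outer u v \<bullet> W = u \<bullet> (W *v v)"
  by (simp add: outer_def inner_vec_def matrix_vector_mult_def sum_distrib_left mult_ac)

lemma transpose_outer: "transpose (outer u v) = outer v u"
  by (simp add: vec_eq_iff outer_def transpose_def)

lemma transpose_sum:
  fixes A :: "'i \<Rightarrow> real^'q^'p"
  shows "transpose (\<Sum>k\<in>I. A k) = (\<Sum>k\<in>I. transpose (A k))"
  by (simp add: vec_eq_iff transpose_def)

lemma transpose_minus: "transpose (A - B) = transpose A - transpose (B :: real^'q^'p)"
  by (simp add: vec_eq_iff transpose_def)

lemma orthonormal_family_subset:
  "orthonormal_family I u \<Longrightarrow> J \<subseteq> I \<Longrightarrow> orthonormal_family J u"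
  unfolding orthonormal_family_def by blast

lemma inner_orthonormal_sum:
  assumes "orthonormal_family I u" "finite I" "j \<in> I"
  shows "u j \<bullet> (\<Sum>k\<in>I. c k *\<^sub>R u k) = c j"
proof -
  have "u j \<bullet> (\<Sum>k\<in>I. c k *\<^sub>R u k) = (\<Sum>k\<in>I. if k = j then c j else 0)"
    unfolding inner_sum_right using assms
    by (intro sum.cong) (auto simp: orthonormal_family_def)
  then show ?thesis using assms by simp
qed

lemma norm_orthonormal_sum:
  assumes "orthonormal_family I u" "finite I"
  shows "(norm (\<Sum>k\<in>I. c k *\<^sub>R u k))\<^sup>2 = (\<Sum>k\<in>I. (c k)\<^sup>2)"
  unfolding power2_norm_eq_inner inner_sum_left
  by (intro sum.cong) (auto simp: inner_orthonormal_sum[OF assms] power2_eq_square)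

lemma orthonormal_expansion:
  fixes u :: "nat \<Rightarrow> 'a::euclidean_space"
  assumes o: "orthonormal_family I u" and "finite I" and c: "card I = DIM('a)"
  shows "v = (\<Sum>k\<in>I. (u k \<bullet> v) *\<^sub>R u k)"
proof -
  let ?w = "v - (\<Sum>k\<in>I. (u k \<bullet> v) *\<^sub>R u k)"
  have "span (u ` I) = UNIV"
    using orthonormal_family_independent(3)[OF o subset_refl \<open>finite I\<close>] c
    by (intro dim_eq_full[THEN iffD1]) simp
  then have "?w \<in> span (u ` I)" by simp
  moreover have "orthogonal ?w y" if "y \<in> u ` I" for y
    using that inner_orthonormal_sum[OF o \<open>finite I\<close>]
    by (auto simp: orthogonal_def inner_diff_left inner_diff_right inner_commute)
  ultimately have "orthogonal ?w ?w"
    by (rule orthogonal_to_span)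
  then show ?thesis by (simp add: orthogonal_self)
qed

text \<open>A dimension count: \<open>m\<close> vectors, orthonormal or not, span a proper subspace,
  and a nonzero vector of its complement can be normalized.\<close>

lemma orthogonal_unit_vector_exists:
  fixes u :: "nat \<Rightarrow> 'a::euclidean_space"
  assumes "m < DIM('a)"
  shows "\<exists>x. norm x = 1 \<and> (\<forall>k\<in>{1..m}. u k \<bullet> x = 0)"
proof -
  have "dim (u ` {1..m}) \<le> card (u ` {1..m})"
    by (rule dim_le_card') simp
  also have "\<dots> \<le> m"
    using card_image_le[of "{1..m}" u] by simp
  finally have "dim (u ` {1..m}) < DIM('a)"
    using assms by simp
  then obtain x where x: "x \<noteq> 0" "\<And>y. y \<in> span (u ` {1..m}) \<Longrightarrow> orthogonal x y"
    using orthogonal_to_subspace_exists by blast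
  have "u k \<bullet> x = 0" if "k \<in> {1..m}" for k
    using x(2)[of "u k"] that by (auto simp: span_base orthogonal_def inner_commute)
  then show ?thesis
    using x(1) by (intro exI[of _ "x /\<^sub>R norm x"]) auto
qed

lemma orthonormal_family_extend:
  assumes "orthonormal_family {1..m} u" "norm x = 1" "\<And>k. k \<in> {1..m} \<Longrightarrow> u k \<bullet> x = 0"
  shows "orthonormal_family {1..Suc m} (u(Suc m := x))"
  using assms unfolding orthonormal_family_def
  by (auto simp: atLeastAtMostSuc_conv inner_commute norm_eq_1)

subsection \<open>Existence of singular value decompositions\<close>

text \<open>First-order variation at a maximizer. Moving from \<open>v\<close> to
  \<open>v + t *\<^sub>R w\<close> changes the squared length of the image by a term linear in
  \<open>t\<close> with coefficient twice the inner product, while maximality allows only growth of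
  order \<open>t\<close> squared.\<close>

lemma maximal_direction_orthogonal:
  fixes A :: "real^'q^'p"
  assumes "subspace S" "v \<in> S" "norm v = 1"
    and max: "\<And>w. w \<in> S \<Longrightarrow> norm (A *v w) \<le> norm (A *v v) * norm w"
    and "w \<in> S" "v \<bullet> w = 0"
  shows "(A *v v) \<bullet> (A *v w) = 0"
proof (rule ccontr)
  let ?b = "(A *v v) \<bullet> (A *v w)" and ?c = "(norm (A *v v))\<^sup>2 * (norm w)\<^sup>2"
  assume b: "?b \<noteq> 0"
  have ineq: "2 * t * ?b \<le> t\<^sup>2 * ?c" for t
  proof -
    have "v + t *\<^sub>R w \<in> S"
      using assms by (simp add: subspace_add subspace_scale)
    then have "(norm (A *v (v + t *\<^sub>R w)))\<^sup>2 \<le> (norm (A *v v))\<^sup>2 * (norm (v + t *\<^sub>R w))\<^sup>2"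
      by (metis max norm_ge_zero power_mono power_mult_distrib)
    also have "(norm (v + t *\<^sub>R w))\<^sup>2 = 1 + t\<^sup>2 * (norm w)\<^sup>2"
      using assms(3,6) unfolding power2_norm_eq_inner
      by (simp add: inner_add_left inner_add_right inner_commute norm_eq_1 power2_eq_square)
    also have "(norm (A *v (v + t *\<^sub>R w)))\<^sup>2
        = (norm (A *v v))\<^sup>2 + 2 * t * ?b + t\<^sup>2 * (norm (A *v w))\<^sup>2"
      unfolding power2_norm_eq_inner
      by (simp add: matrix_vector_right_distrib matrix_vector_mult_scaleR inner_add_left inner_add_right inner_commute power2_eq_square algebra_simps)
    finally have "(norm (A *v v))\<^sup>2 + 2 * t * ?b + t\<^sup>2 * (norm (A *v w))\<^sup>2
        \<le> (norm (A *v v))\<^sup>2 + t\<^sup>2 * ?c"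
      by (simp add: algebra_simps)
    moreover have "0 \<le> t\<^sup>2 * (norm (A *v w))\<^sup>2" by simp
    ultimately show ?thesis by linarith
  qed
  have c: "0 \<le> ?c" by simp
  \<comment> \<open>With this step size the inequality becomes
    \<open>(2 + ?c) * t\<^sup>2 \<le> 0\<close>. The summand 1 keeps the denominator positive
    without a separate argument about \<open>?c\<close>.\<close>
  define t where "t = ?b / (1 + ?c)"
  have "1 + ?c \<noteq> 0" using c by linarith
  then have "?b = (1 + ?c) * t"
    unfolding t_def by (metis nonzero_mult_div_cancel_left times_divide_eq_right)
  then have "2 * t * ?b = 2 * (1 + ?c) * t\<^sup>2"
    by (simp add: power2_eq_square)
  with ineq[of t] have "(2 + ?c) * t\<^sup>2 \<le> 0"
    by (simp add: algebra_simps)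
  moreover have "0 < t\<^sup>2"
    using b \<open>1 + ?c \<noteq> 0\<close> unfolding t_def by (simp only: zero_less_power2 divide_eq_0_iff simp_thms)
  ultimately show False
    using c by (simp add: mult_le_0_iff)
qed

text \<open>Singular triples are chosen greedily by induction on their number. The last clause is
  the invariant that drives the step: on vectors orthogonal to the chosen \<open>Q k\<close>, the
  image is orthogonal to the chosen \<open>P k\<close>, which makes the next left vector orthogonal,
  and its length is controlled by every chosen \<open>\<Lambda> k\<close>, which makes the next
  singular value no larger.\<close>

lemma partial_svd_exists:
  fixes A :: "real^'q^'p"
  assumes "CARD('q) \<le> CARD('p)" "m \<le> CARD('q)"
  shows "\<exists>P \<Lambda> Q. orthonormal_family {1..m} P \<and> orthonormal_family {1..m} Q \<and>
    antimono_on {1..m} \<Lambda> \<and> (\<forall>k\<in>{1..m}. 0 \<le> \<Lambda> k \<and> A *v Q k = \<Lambda> k *\<^sub>R P k) \<and>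
    (\<forall>v. (\<forall>k\<in>{1..m}. Q k \<bullet> v = 0) \<longrightarrow>
      (\<forall>k\<in>{1..m}. P k \<bullet> (A *v v) = 0 \<and> norm (A *v v) \<le> \<Lambda> k * norm v))"
  using assms(2)
proof (induction m)
  case 0
  then show ?case by (simp add: orthonormal_family_def monotone_on_def)
next
  case (Suc m)
  then obtain P \<Lambda> Q where oP: "orthonormal_family {1..m} P" and oQ: "orthonormal_family {1..m} Q"
    and anti: "antimono_on {1..m} \<Lambda>"
    and nn: "\<And>k. k \<in> {1..m} \<Longrightarrow> 0 \<le> \<Lambda> k"
    and AQ: "\<And>k. k \<in> {1..m} \<Longrightarrow> A *v Q k = \<Lambda> k *\<^sub>R P k"
    and orth: "\<And>v k. (\<And>j. j \<in> {1..m} \<Longrightarrow> Q j \<bullet> v = 0) \<Longrightarrow> k \<in> {1..m} \<Longrightarrow> P k \<bullet> (A *v v) = 0"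
    and bound: "\<And>v k. (\<And>j. j \<in> {1..m} \<Longrightarrow> Q j \<bullet> v = 0) \<Longrightarrow> k \<in> {1..m} \<Longrightarrow>
        norm (A *v v) \<le> \<Lambda> k * norm v"
    by (metis Suc_leD)
  \<comment> \<open>The next right singular vector maximizes \<open>norm (A *v v)\<close> over the
    unit sphere of this orthogonal complement; compactness provides the maximum.\<close>
  define S where "S = {v. \<forall>k\<in>{1..m}. Q k \<bullet> v = 0}"
  have S: "subspace S"
    unfolding S_def subspace_def by (auto simp: inner_add_right)
  have "closed S"
    using S by (rule closed_subspace)
  then have "compact (sphere 0 1 \<inter> S)"
    by (simp add: compact_Int_closed)
  moreover have "sphere 0 1 \<inter> S \<noteq> {}"
    using orthogonal_unit_vector_exists[of m Q] Suc.prems by (auto simp: S_def)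
  moreover have "continuous_on (sphere 0 1 \<inter> S) (\<lambda>v. norm (A *v v))"
    by (intro continuous_intros linear_continuous_on matrix_vector_mul_bounded_linear)
  ultimately obtain v where v: "v \<in> S" "norm v = 1"
    and vmax: "\<And>w. w \<in> S \<Longrightarrow> norm w = 1 \<Longrightarrow> norm (A *v w) \<le> norm (A *v v)"
    using continuous_attains_sup[of "sphere 0 1 \<inter> S" "\<lambda>v. norm (A *v v)"]
    by (metis IntD1 IntD2 IntI mem_sphere_0)
  have max: "norm (A *v w) \<le> norm (A *v v) * norm w" if "w \<in> S" for w
  proof (cases "w = 0")
    case False
    then have "norm (A *v (w /\<^sub>R norm w)) \<le> norm (A *v v)"
      using that S by (intro vmax) (auto simp: subspace_scale)
    then show ?thesis
      using False by (simp add: matrix_vector_mult_scaleR field_simps)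
  qed simp
  let ?\<sigma> = "norm (A *v v)"
  \<comment> \<open>If \<open>A *v v\<close> is nonzero, it is normalized. If it vanishes, the
    singular value is 0 and any unit vector orthogonal to the earlier left vectors serves; one
    exists because \<open>CARD('q) \<le> CARD('p)\<close>.\<close>
  obtain x where x: "norm x = 1" "\<And>k. k \<in> {1..m} \<Longrightarrow> P k \<bullet> x = 0" "A *v v = ?\<sigma> *\<^sub>R x"
  proof (cases "A *v v = 0")
    case True
    have "m < DIM(real^'p)"
      using Suc.prems assms(1) by simp
    from orthogonal_unit_vector_exists[OF this, of P] show ?thesis
      using True that by auto
  next
    case False
    show ?thesis
    proof (rule that[of "(A *v v) /\<^sub>R ?\<sigma>"])
      fix k assume "k \<in> {1..m}"
      then show "P k \<bullet> ((A *v v) /\<^sub>R ?\<sigma>) = 0"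
        using orth[of v k] v by (auto simp: S_def)
    qed (use False in auto)
  qed
  have mem: "w \<in> S \<and> v \<bullet> w = 0" if "\<forall>k\<in>{1..Suc m}. (Q(Suc m := v)) k \<bullet> w = 0" for w
    using that by (auto simp: S_def atLeastAtMostSuc_conv)
  show ?case
  proof (intro exI[of _ "P(Suc m := x)"] exI[of _ "\<Lambda>(Suc m := ?\<sigma>)"] exI[of _ "Q(Suc m := v)"]
      conjI)
    show "orthonormal_family {1..Suc m} (P(Suc m := x))"
      using oP x by (intro orthonormal_family_extend)
    show "orthonormal_family {1..Suc m} (Q(Suc m := v))"
      using oQ v by (intro orthonormal_family_extend) (auto simp: S_def)
    have "?\<sigma> \<le> \<Lambda> k" if "k \<in> {1..m}" for k
      using bound[of v k] v that by (auto simp: S_def)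
    then show "antimono_on {1..Suc m} (\<Lambda>(Suc m := ?\<sigma>))"
      using anti unfolding monotone_on_def by (auto simp: atLeastAtMostSuc_conv)
    show "\<forall>k\<in>{1..Suc m}. 0 \<le> (\<Lambda>(Suc m := ?\<sigma>)) k \<and>
        A *v (Q(Suc m := v)) k = (\<Lambda>(Suc m := ?\<sigma>)) k *\<^sub>R (P(Suc m := x)) k"
      using nn AQ x(3) by (auto simp: atLeastAtMostSuc_conv)
    show "\<forall>w. (\<forall>k\<in>{1..Suc m}. (Q(Suc m := v)) k \<bullet> w = 0) \<longrightarrow>
        (\<forall>k\<in>{1..Suc m}. (P(Suc m := x)) k \<bullet> (A *v w) = 0 \<and>
          norm (A *v w) \<le> (\<Lambda>(Suc m := ?\<sigma>)) k * norm w)"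
    proof (intro allI impI)
      fix w assume "\<forall>k\<in>{1..Suc m}. (Q(Suc m := v)) k \<bullet> w = 0"
      then have w: "w \<in> S" "v \<bullet> w = 0" using mem by blast+
      have old: "P k \<bullet> (A *v w) = 0 \<and> norm (A *v w) \<le> \<Lambda> k * norm w" if "k \<in> {1..m}" for k
        using orth[of w k] bound[of w k] w(1) that by (auto simp: S_def)
      have "?\<sigma> * (x \<bullet> (A *v w)) = (A *v v) \<bullet> (A *v w)"
        by (metis x(3) inner_scaleR_left)
      also have "\<dots> = 0"
        by (rule maximal_direction_orthogonal[OF S v max w])
      finally have "x \<bullet> (A *v w) = 0 \<or> ?\<sigma> = 0" by auto
      \<comment> \<open>If the new singular value is 0, maximality forces
        \<open>A *v w = 0\<close>.\<close>
      then have "x \<bullet> (A *v w) = 0"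
        using max[OF w(1)] by auto
      then show "\<forall>k\<in>{1..Suc m}. (P(Suc m := x)) k \<bullet> (A *v w) = 0 \<and>
          norm (A *v w) \<le> (\<Lambda>(Suc m := ?\<sigma>)) k * norm w"
        using old max[OF w(1)] by (auto simp: atLeastAtMostSuc_conv)
    qed
  qed
qed

text \<open>After \<open>CARD('q)\<close> steps the right singular vectors form an orthonormal
  basis, so \<open>A\<close> is determined by its values on them.\<close>

lemma svd_exists:
  fixes A :: "real^'q^'p"
  assumes "CARD('q) \<le> CARD('p)"
  obtains P \<Lambda> Q where "is_svd A P \<Lambda> Q"
proof -
  let ?I = "{1..CARD('q)}"
  obtain P \<Lambda> Q where svd: "orthonormal_family ?I P" "orthonormal_family ?I Q"
    "antimono_on ?I \<Lambda>" "\<And>k. k \<in> ?I \<Longrightarrow> 0 \<le> \<Lambda> k"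
    and AQ: "\<And>k. k \<in> ?I \<Longrightarrow> A *v Q k = \<Lambda> k *\<^sub>R P k"
    using partial_svd_exists[OF assms order_refl, of A] by blast
  have "A = (\<Sum>k\<in>?I. \<Lambda> k *\<^sub>R outer (P k) (Q k))"
  proof (rule matrix_eq[THEN iffD2, rule_format])
    fix v
    have "A *v v = A *v (\<Sum>k\<in>?I. (Q k \<bullet> v) *\<^sub>R Q k)"
      using orthonormal_expansion[OF svd(2), of v] by simp
    also have "\<dots> = (\<Sum>k\<in>?I. (Q k \<bullet> v) *\<^sub>R (\<Lambda> k *\<^sub>R P k))"
      using AQ by (simp add: linear_sum[OF matrix_vector_mul_linear] matrix_vector_mult_scaleR)
    also have "\<dots> = (\<Sum>k\<in>?I. \<Lambda> k *\<^sub>R outer (P k) (Q k)) *v v"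
      unfolding sum_matrix_vec
      by (intro sum.cong) (auto simp: scaleR_matrix_vector_assoc[symmetric] outer_mult_vec)
    finally show "A *v v = (\<Sum>k\<in>?I. \<Lambda> k *\<^sub>R outer (P k) (Q k)) *v v" .
  qed
  with svd show thesis
    by (intro that) (auto simp: is_svd_def)
qed

subsection \<open>Projections onto leading singular vectors\<close>

lemma proj_first_mult_vec: "proj_first s u *v x = (\<Sum>k=1..s. (u k \<bullet> x) *\<^sub>R u k)"
  by (simp add: proj_first_def sum_matrix_vec outer_mult_vec)

lemma transpose_proj_first: "transpose (proj_first s u) = proj_first s u"
  by (simp add: proj_first_def transpose_sum transpose_outer)

lemma proj_first_idem:
  assumes "orthonormal_family {1..s} u"
  shows "proj_first s u ** proj_first s u = proj_first s u"
  by (rule matrix_eq[THEN iffD2, rule_format])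
    (simp add: matrix_vector_mul_assoc[symmetric] proj_first_mult_vec
      inner_orthonormal_sum[OF assms] del: One_nat_def)

text \<open>The projection is symmetric and idempotent, so the cross term between the two components
  vanishes.\<close>

lemma proj_first_pythagoras:
  fixes u :: "nat \<Rightarrow> real^'n"
  assumes "orthonormal_family {1..s} u"
  shows "(norm (proj_first s u *v x))\<^sup>2 + (norm ((mat 1 - proj_first s u) *v x))\<^sup>2 = (norm x)\<^sup>2"
proof -
  let ?y = "proj_first s u *v x"
  have "?y \<bullet> ?y = x \<bullet> ?y"
    by (metis assms dot_lmul_matrix matrix_vector_mul_assoc proj_first_idem transpose_proj_first
        vector_transpose_matrix)
  then show ?thesis
    by (simp add: matrix_vector_mult_diff_rdistrib power2_norm_eq_inner inner_diff_left
        inner_diff_right inner_commute)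
qed

lemma norm_proj_first_le:
  assumes "orthonormal_family {1..s} u"
  shows "norm (proj_first s u *v x) \<le> norm x" "norm ((mat 1 - proj_first s u) *v x) \<le> norm x"
proof -
  have "(norm (proj_first s u *v x))\<^sup>2 \<le> (norm x)\<^sup>2"
    and "(norm ((mat 1 - proj_first s u) *v x))\<^sup>2 \<le> (norm x)\<^sup>2"
    unfolding proj_first_pythagoras[OF assms, of x, symmetric] by simp_all
  then show "norm (proj_first s u *v x) \<le> norm x" "norm ((mat 1 - proj_first s u) *v x) \<le> norm x"
    by simp_all
qed

text \<open>Symmetry and idempotence reduce the squared norm of the projected matrix to its inner
  product with \<open>A\<close>; Cauchy-Schwarz then leaves one factor to cancel.\<close>

lemma norm_proj_first_matrix_le:
  fixes A :: "real^'q^'p"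
  assumes "orthonormal_family {1..s} u"
  shows "norm (proj_first s u ** A) \<le> norm A"
proof -
  let ?C = "proj_first s u ** A"
  have "norm ?C * norm ?C = ?C \<bullet> ?C"
    by (simp add: power2_norm_eq_inner[symmetric] power2_eq_square)
  also have "\<dots> = A \<bullet> ?C"
    by (simp add: inner_matrix_mult_left transpose_proj_first matrix_mul_assoc
        proj_first_idem[OF assms])
  also have "\<dots> \<le> norm A * norm ?C" by (rule norm_cauchy_schwarz)
  finally show ?thesis
    by (metis mult_right_le_imp_le norm_ge_zero order_le_less)
qed

lemma norm_matrix_proj_first_le:
  fixes A :: "real^'q^'p"
  assumes "orthonormal_family {1..s} u"
  shows "norm (A ** proj_first s u) \<le> norm A"
proof -
  let ?C = "A ** proj_first s u"
  have "norm ?C * norm ?C = ?C \<bullet> ?C"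
    by (simp add: power2_norm_eq_inner[symmetric] power2_eq_square)
  also have "\<dots> = A \<bullet> ?C"
    by (simp add: inner_matrix_mult_right transpose_proj_first matrix_mul_assoc[symmetric]
        proj_first_idem[OF assms])
  also have "\<dots> \<le> norm A * norm ?C" by (rule norm_cauchy_schwarz)
  finally show ?thesis
    by (metis mult_right_le_imp_le norm_ge_zero order_le_less)
qed

text \<open>The source of the factor 3 in the argument of the conjugate: each of the three projected
  matrices has Frobenius norm at most \<open>norm A\<close>.\<close>

lemma Omega_plus_le:
  assumes "orthonormal_family {1..s} P" "orthonormal_family {1..s} Q"
  shows "Omega_plus s P Q A \<le> 3 * sqrt (real s) * norm A"
proof -
  have "norm (proj_first s P ** A ** proj_first s Q) \<le> norm A"
    by (metis assms norm_matrix_proj_first_le norm_proj_first_matrix_le order_trans)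
  then have "norm (proj_first s P ** A) + norm (A ** proj_first s Q)
        + norm (proj_first s P ** A ** proj_first s Q) \<le> 3 * norm A"
    using norm_proj_first_matrix_le[OF assms(1), of A]
      norm_matrix_proj_first_le[OF assms(2), of A] by linarith
  then have "Omega_plus s P Q A \<le> sqrt (real s) * (3 * norm A)"
    unfolding Omega_plus_def by (intro mult_left_mono) auto
  then show ?thesis by (simp add: mult_ac)
qed

subsection \<open>Duality for the nuclear norm\<close>

text \<open>For orthonormal families this is the partial isometry that sends \<open>Q k\<close> to
  \<open>P k\<close> for \<open>k\<close> up to \<open>s\<close> and vanishes on the orthogonal
  complement of these \<open>Q k\<close>.\<close>

definition polar_factor :: "nat \<Rightarrow> (nat \<Rightarrow> real^'p) \<Rightarrow> (nat \<Rightarrow> real^'q) \<Rightarrow> real^'q^'p" where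
  "polar_factor s P Q = (\<Sum>k=1..s. outer (P k) (Q k))"

lemma polar_factor_mult_vec: "polar_factor s P Q *v x = (\<Sum>k=1..s. (Q k \<bullet> x) *\<^sub>R P k)"
  by (simp add: polar_factor_def sum_matrix_vec outer_mult_vec)

lemma norm_polar_factor_mult_vec:
  assumes "orthonormal_family {1..s} P" "orthonormal_family {1..s} Q"
  shows "norm (polar_factor s P Q *v x) = norm (proj_first s Q *v x)"
proof -
  have "(norm (polar_factor s P Q *v x))\<^sup>2 = (norm (proj_first s Q *v x))\<^sup>2"
    by (simp add: polar_factor_mult_vec proj_first_mult_vec norm_orthonormal_sum[OF assms(1)]
        norm_orthonormal_sum[OF assms(2)] del: One_nat_def)
  then show ?thesis by simp
qed

lemma inner_polar_factor:
  assumes "orthonormal_family {1..s} P" "orthonormal_family {1..s} Q" "k \<in> {1..s}"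
  shows "P k \<bullet> (polar_factor s P Q *v Q k) = 1"
  using assms(2,3) inner_orthonormal_sum[OF assms(1) _ assms(3), of "\<lambda>j. Q j \<bullet> Q k"]
  by (simp add: polar_factor_mult_vec orthonormal_family_def)

text \<open>In the singular value decomposition of \<open>A\<close> each \<open>\<Lambda> k\<close>
  is multiplied by \<open>P k \<bullet> (W *v Q k)\<close>, which is at most 1 because both vectors
  are unit and \<open>W\<close> is a contraction.\<close>

lemma nuclear_norm_ge_inner:
  fixes A W :: "real^'q^'p"
  assumes "CARD('q) \<le> CARD('p)" and W: "\<And>v. norm (W *v v) \<le> norm v"
  shows "A \<bullet> W \<le> nuclear_norm A"
proof -
  obtain P \<Lambda> Q where svd: "is_svd A P \<Lambda> Q"
    using svd_exists[OF assms(1)] .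
  have "A \<bullet> W = (\<Sum>k=1..CARD('q). \<Lambda> k * (P k \<bullet> (W *v Q k)))"
    using svd by (simp add: is_svd_def inner_sum_left inner_outer)
  also have "\<dots> \<le> (\<Sum>k=1..CARD('q). \<Lambda> k)"
  proof (rule sum_mono)
    fix k assume k: "k \<in> {1..CARD('q)}"
    then have "norm (P k) = 1" "norm (Q k) = 1" "0 \<le> \<Lambda> k"
      using svd by (auto simp: is_svd_def orthonormal_family_def norm_eq_1)
    moreover have "P k \<bullet> (W *v Q k) \<le> norm (P k) * norm (W *v Q k)"
      by (rule norm_cauchy_schwarz)
    ultimately have "P k \<bullet> (W *v Q k) \<le> 1"
      using W[of "Q k"] by simp
    then show "\<Lambda> k * (P k \<bullet> (W *v Q k)) \<le> \<Lambda> k"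
      using \<open>0 \<le> \<Lambda> k\<close> by (simp add: mult_left_le)
  qed
  finally show ?thesis
    by (simp add: nuclear_norm_svd[OF svd])
qed

text \<open>The polar factor built from all \<open>CARD('q)\<close> singular pairs of
  \<open>A\<close> is a contraction for which every term of the previous estimate is an
  equality.\<close>

lemma nuclear_norm_dual_attained:
  fixes A :: "real^'q^'p"
  assumes "CARD('q) \<le> CARD('p)"
  shows "\<exists>W. (\<forall>v. norm (W *v v) \<le> norm v) \<and> A \<bullet> W = nuclear_norm A"
proof -
  obtain P \<Lambda> Q where svd: "is_svd A P \<Lambda> Q"
    using svd_exists[OF assms] .
  let ?I = "{1..CARD('q)}"
  have oP: "orthonormal_family ?I P" and oQ: "orthonormal_family ?I Q"
    and A: "A = (\<Sum>k\<in>?I. \<Lambda> k *\<^sub>R outer (P k) (Q k))"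
    using svd by (auto simp: is_svd_def)
  let ?W = "polar_factor (CARD('q)) P Q"
  have "A \<bullet> ?W = nuclear_norm A"
    unfolding nuclear_norm_svd[OF svd]
    by (subst A) (simp add: inner_sum_left inner_outer inner_polar_factor[OF oP oQ])
  moreover have "norm (?W *v v) \<le> norm v" for v
    using norm_polar_factor_mult_vec[OF oP oQ] norm_proj_first_le(1)[OF oQ] by simp
  ultimately show ?thesis by blast
qed

lemma nuclear_norm_nonneg:
  fixes A :: "real^'q^'p"
  assumes "CARD('q) \<le> CARD('p)"
  shows "0 \<le> nuclear_norm A"
  using nuclear_norm_ge_inner[OF assms, of 0 A] by simp

text \<open>A maximum of linear functionals is sublinear: the contraction that is optimal for the
  combination is a competitor for each of its summands.\<close>

lemma nuclear_norm_convex_comb: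
  fixes A C :: "real^'q^'p"
  assumes card: "CARD('q) \<le> CARD('p)" and "0 \<le> a" "0 \<le> b"
  shows "nuclear_norm (a *\<^sub>R A + b *\<^sub>R C) \<le> a * nuclear_norm A + b * nuclear_norm C"
proof -
  obtain W where W: "\<And>v. norm (W *v v) \<le> norm v"
    and eq: "(a *\<^sub>R A + b *\<^sub>R C) \<bullet> W = nuclear_norm (a *\<^sub>R A + b *\<^sub>R C)"
    using nuclear_norm_dual_attained[OF card, of "a *\<^sub>R A + b *\<^sub>R C"] by blast
  have "a * (A \<bullet> W) + b * (C \<bullet> W) \<le> a * nuclear_norm A + b * nuclear_norm C"
    using assms nuclear_norm_ge_inner[OF card W] by (intro add_mono mult_left_mono) auto
  then show ?thesis
    using eq by (simp add: inner_add_left)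
qed

section \<open>The dual certificate at the leading singular vectors\<close>

lemma proj_first_complement_mult:
  assumes "orthonormal_family {1..s} u"
  shows "proj_first s u *v ((mat 1 - proj_first s u) *v x) = 0"
proof -
  have "proj_first s u *v (proj_first s u *v x) = proj_first s u *v x"
    by (simp add: matrix_vector_mul_assoc proj_first_idem[OF assms])
  then show ?thesis
    by (simp add: matrix_vector_mult_diff_rdistrib matrix_vector_mult_diff_distrib)
qed

lemma proj_first_base:
  assumes "orthonormal_family {1..n} u" "s \<le> n" "k \<in> {1..n}"
  shows "proj_first s u *v u k = (if k \<le> s then u k else 0)"
proof -
  have "proj_first s u *v u k = (\<Sum>j=1..s. if j = k then u k else 0)"
    unfolding proj_first_mult_vec using assms
    by (intro sum.cong) (auto simp: orthonormal_family_def)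
  then show ?thesis using assms(3) by auto
qed

lemma norm_polar_factor:
  assumes "orthonormal_family {1..s} P" "orthonormal_family {1..s} Q"
  shows "norm (polar_factor s P Q) = sqrt (real s)"
proof -
  have "polar_factor s P Q \<bullet> polar_factor s P Q
      = (\<Sum>k=1..s. P k \<bullet> (polar_factor s P Q *v Q k))"
    by (subst polar_factor_def) (simp add: inner_sum_left inner_outer)
  also have "\<dots> = real s" by (simp add: inner_polar_factor[OF assms])
  finally show ?thesis by (simp add: norm_eq_sqrt_inner)
qed

text \<open>
  The dual certificate is the polar factor of \<open>B\<^sup>+\<close> plus the compression to the complementary spaces
  of a contraction attaining the nuclear norm of the compressed difference.
\<close>

lemma nuclear_norm_triangle_property:
  fixes B D :: "real^'q^'p"
  assumes card: "CARD('q) \<le> CARD('p)" and svd: "is_svd B P \<Lambda> Q" and s: "s \<le> CARD('q)"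
  shows "nuclear_norm B - nuclear_norm (B + D)
    \<le> Omega_plus s P Q D - Omega_minus s P Q D + 2 * nuclear_norm (B_minus s P \<Lambda> Q)"
proof -
  let ?I = "{1..CARD('q)}"
  let ?p = "proj_first s P" and ?q = "proj_first s Q" and ?W1 = "polar_factor s P Q"
  let ?p' = "mat 1 - ?p" and ?q' = "mat 1 - ?q" and ?Bm = "B_minus s P \<Lambda> Q"
  have oP': "orthonormal_family ?I P" and oQ': "orthonormal_family ?I Q"
    and nn: "\<And>k. k \<in> ?I \<Longrightarrow> 0 \<le> \<Lambda> k"
    and B: "B = (\<Sum>k\<in>?I. \<Lambda> k *\<^sub>R outer (P k) (Q k))"
    using svd by (auto simp: is_svd_def)
  have oP: "orthonormal_family {1..s} P" and oQ: "orthonormal_family {1..s} Q"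
    using orthonormal_family_subset[OF oP'] orthonormal_family_subset[OF oQ'] s by auto
  have tp: "transpose ?p' = ?p'" and tq: "transpose ?q' = ?q'"
    by (simp_all add: transpose_minus transpose_mat transpose_proj_first)
  obtain W2 where W2: "\<And>v. norm (W2 *v v) \<le> norm v"
    and eq2: "(?p' ** D ** ?q') \<bullet> W2 = nuclear_norm (?p' ** D ** ?q')"
    using nuclear_norm_dual_attained[OF card, of "?p' ** D ** ?q'"] by blast
  define C2 where "C2 = ?p' ** W2 ** ?q'"
  have C2v: "C2 *v v = ?p' *v (W2 *v (?q' *v v))" for v
    by (simp add: C2_def matrix_vector_mul_assoc matrix_mul_assoc)
  \<comment> \<open>The two summands have orthogonal ranges, and they act on the complementary
    components \<open>?q *v v\<close> and \<open>?q' *v v\<close>. Pythagoras in the range and in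
    the domain then gives the contraction property.\<close>
  have W: "norm ((?W1 + C2) *v v) \<le> norm v" for v
  proof -
    have "?p *v (?W1 *v v) = ?W1 *v v"
      unfolding polar_factor_mult_vec
      by (simp add: proj_first_mult_vec inner_orthonormal_sum[OF oP] del: One_nat_def)
    then have "(?W1 *v v) \<bullet> (C2 *v v) = (?p *v (?W1 *v v)) \<bullet> (C2 *v v)" by simp
    also have "\<dots> = (?W1 *v v) \<bullet> (?p *v (C2 *v v))"
      by (metis dot_lmul_matrix transpose_proj_first vector_transpose_matrix)
    also have "\<dots> = 0"
      by (simp add: C2v proj_first_complement_mult[OF oP])
    finally have "(norm ((?W1 + C2) *v v))\<^sup>2 = (norm (?W1 *v v))\<^sup>2 + (norm (C2 *v v))\<^sup>2"
      by (simp add: matrix_vector_mult_add_rdistrib power2_norm_eq_inner inner_add_left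
          inner_add_right inner_commute)
    also have "\<dots> \<le> (norm (?q *v v))\<^sup>2 + (norm (?q' *v v))\<^sup>2"
    proof (intro add_mono power_mono norm_ge_zero)
      show "norm (?W1 *v v) \<le> norm (?q *v v)"
        by (simp add: norm_polar_factor_mult_vec[OF oP oQ])
      show "norm (C2 *v v) \<le> norm (?q' *v v)"
        unfolding C2v by (rule order_trans[OF norm_proj_first_le(2)[OF oP] W2])
    qed
    also have "\<dots> = (norm v)\<^sup>2"
      by (rule proj_first_pythagoras[OF oQ])
    finally show ?thesis by (rule power2_le_imp_le) simp
  qed
  have split: "(\<Sum>k\<in>?I. f k) = (\<Sum>k=1..s. f k) + (\<Sum>k=s+1..CARD('q). f k)"
    for f :: "nat \<Rightarrow> 'a::comm_monoid_add"
    using s sum.ub_add_nat[of 1 s f "CARD('q) - s"] by simp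
  have W1k: "P k \<bullet> (?W1 *v Q k) = (if k \<le> s then 1 else 0)" if "k \<in> ?I" for k
  proof -
    have "P k \<bullet> (?W1 *v Q k) = (\<Sum>j=1..s. if j = k then 1 else 0)"
      unfolding polar_factor_mult_vec inner_sum_right using that oP' oQ' s
      by (intro sum.cong) (auto simp: orthonormal_family_def)
    then show ?thesis using that by simp
  qed
  have C2k: "P k \<bullet> (C2 *v Q k) = (if k \<le> s then 0 else P k \<bullet> (W2 *v Q k))" if "k \<in> ?I" for k
  proof -
    have "P k \<bullet> (C2 *v Q k) = (?p' *v P k) \<bullet> (W2 *v (?q' *v Q k))"
      unfolding C2v by (metis dot_lmul_matrix tp vector_transpose_matrix)
    then show ?thesis
      using proj_first_base[OF oP' s that] proj_first_base[OF oQ' s that]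
      by (auto simp: matrix_vector_mult_diff_rdistrib)
  qed
  \<comment> \<open>On the singular pairs of \<open>B\<close> the certificate equals 1 for
    \<open>k \<le> s\<close> and agrees with \<open>W2\<close> beyond, so \<open>W2\<close> meets
    \<open>B\<close> only through its tail \<open>?Bm\<close>.\<close>
  have "B \<bullet> (?W1 + C2) = (\<Sum>k\<in>?I. \<Lambda> k * (P k \<bullet> (?W1 *v Q k) + P k \<bullet> (C2 *v Q k)))"
    by (subst B) (simp add: inner_sum_left inner_outer matrix_vector_mult_add_rdistrib
        inner_add_right distrib_left sum.distrib)
  also have "\<dots> = (\<Sum>k\<in>?I. if k \<le> s then \<Lambda> k else \<Lambda> k * (P k \<bullet> (W2 *v Q k)))"
    by (intro sum.cong) (auto simp: W1k C2k)
  also have "\<dots> = (\<Sum>k=1..s. \<Lambda> k) + ?Bm \<bullet> W2"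
    unfolding split by (simp add: B_minus_def inner_sum_left inner_outer)
  finally have BW: "B \<bullet> (?W1 + C2) = (\<Sum>k=1..s. \<Lambda> k) + ?Bm \<bullet> W2" .
  \<comment> \<open>Duality with the contraction \<open>- W2\<close> bounds the tail pairing from
    below. This costs the first of the two copies of \<open>nuclear_norm ?Bm\<close>.\<close>
  have "norm (- W2 *v v) \<le> norm v" for v
    using W2[of v] matrix_vector_mult_diff_rdistrib[of 0 W2 v] by simp
  then have "?Bm \<bullet> (- W2) \<le> nuclear_norm ?Bm"
    by (rule nuclear_norm_ge_inner[OF card])
  then have BmW2: "- nuclear_norm ?Bm \<le> ?Bm \<bullet> W2" by simp
  have DC2: "D \<bullet> C2 = Omega_minus s P Q D"
    using eq2 inner_matrix_mult_right[of "?p' ** D" ?q' W2]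
      inner_matrix_mult_left[of ?p' D "W2 ** ?q'"]
    by (simp add: Omega_minus_def C2_def tp tq matrix_mul_assoc)
  \<comment> \<open>The range of \<open>?W1\<close> lies in that of \<open>?p\<close>, so
    Cauchy-Schwarz may be applied to \<open>?p ** D\<close> in place of \<open>D\<close>. This
    yields the first summand of \<open>Omega_plus\<close>; the other two are nonnegative.\<close>
  have "?p ** ?W1 = ?W1"
    by (rule matrix_eq[THEN iffD2, rule_format])
      (simp add: matrix_vector_mul_assoc[symmetric] polar_factor_mult_vec proj_first_mult_vec
        inner_orthonormal_sum[OF oP] del: One_nat_def)
  then have "D \<bullet> ?W1 = (?p ** D) \<bullet> ?W1"
    by (simp add: inner_matrix_mult_left transpose_proj_first)
  then have "\<bar>D \<bullet> ?W1\<bar> \<le> norm (?p ** D) * sqrt (real s)"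
    using Cauchy_Schwarz_ineq2[of "?p ** D" ?W1] by (simp add: norm_polar_factor[OF oP oQ])
  also have "\<dots> \<le> Omega_plus s P Q D"
    unfolding Omega_plus_def by (simp add: mult.commute mult_left_mono)
  finally have DW1: "- Omega_plus s P Q D \<le> D \<bullet> ?W1" by linarith
  \<comment> \<open>The second copy: the full polar factor is a contraction whose pairing with
    \<open>?Bm\<close> is the tail sum, so duality bounds that sum without exhibiting a singular
    value decomposition of \<open>?Bm\<close>.\<close>
  have "(\<Sum>k=s+1..CARD('q). \<Lambda> k) = ?Bm \<bullet> polar_factor (CARD('q)) P Q"
    by (auto simp: B_minus_def inner_sum_left inner_outer inner_polar_factor[OF oP' oQ'])
  also have "\<dots> \<le> nuclear_norm ?Bm"
    using norm_polar_factor_mult_vec[OF oP' oQ'] norm_proj_first_le(1)[OF oQ']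
    by (intro nuclear_norm_ge_inner[OF card]) simp
  finally have "nuclear_norm B \<le> (\<Sum>k=1..s. \<Lambda> k) + nuclear_norm ?Bm"
    unfolding nuclear_norm_svd[OF svd] split by simp
  moreover have "(B + D) \<bullet> (?W1 + C2) \<le> nuclear_norm (B + D)"
    by (rule nuclear_norm_ge_inner[OF card W])
  moreover have "(B + D) \<bullet> (?W1 + C2) = B \<bullet> (?W1 + C2) + (D \<bullet> ?W1 + D \<bullet> C2)"
    by (simp add: inner_add_left inner_add_right)
  ultimately show ?thesis
    using BW BmW2 DC2 DW1 by linarith
qed

subsection \<open>The sharp oracle inequality\<close>

lemma has_derivative_directional:
  fixes f :: "'a::real_normed_vector \<Rightarrow> real"
  assumes f: "(f has_derivative F) (at x)"
  shows "((\<lambda>t. f (x + t *\<^sub>R e)) has_field_derivative F e) (at 0)"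
proof -
  interpret F: bounded_linear F
    using f by (rule has_derivative_bounded_linear)
  have "(f has_derivative F) (at (x + 0 *\<^sub>R e))" using f by simp
  then have "((\<lambda>t. f (x + t *\<^sub>R e)) has_derivative (\<lambda>t. F (t *\<^sub>R e))) (at 0)"
    by (rule has_derivative_compose[rotated]) (auto intro!: derivative_eq_intros)
  then show ?thesis
    by (simp add: has_field_derivative_def F.scaleR mult_commute_abs)
qed

text \<open>Under total differentiability the matrix of partial derivatives is the gradient; this
  follows by expanding \<open>E\<close> in matrix units.\<close>

lemma partials_inner:
  fixes f :: "real^'q^'p \<Rightarrow> real"
  assumes f: "(f has_derivative F) (at A)"
  shows "partials f A \<bullet> E = F E"
proof -
  interpret F: bounded_linear F
    using f by (rule has_derivative_bounded_linear)
  have p: "partials f A $ i $ j = F (axis i (axis j 1))" for i j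
    by (simp add: partials_def DERIV_imp_deriv[OF has_derivative_directional[OF f]])
  \<comment> \<open>A condition free of the summation index is pulled out of the sum, so that the
    nested conditionals from the two \<open>axis\<close> terms collapse.\<close>
  have "(\<Sum>j\<in>J. if c then g j else 0) = (if c then sum g J else 0)"
    for g :: "'q \<Rightarrow> real" and c J
    by simp
  then have "E = (\<Sum>i\<in>UNIV. \<Sum>j\<in>UNIV. E $ i $ j *\<^sub>R axis i (axis j 1))"
    by (simp add: vec_eq_iff axis_def if_distrib[of "\<lambda>v. v $ _"] if_distrib[of "\<lambda>v. _ * v"] cong: if_cong)
  then have "F E = F (\<Sum>i\<in>UNIV. \<Sum>j\<in>UNIV. E $ i $ j *\<^sub>R axis i (axis j 1))"
    by (rule arg_cong)
  also have "\<dots> = (\<Sum>i\<in>UNIV. \<Sum>j\<in>UNIV. E $ i $ j * F (axis i (axis j 1)))"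
    by (simp add: F.sum F.scaleR)
  finally show ?thesis
    by (simp add: inner_vec_def p mult.commute)
qed

text \<open>Each residual is affine in the matrix, so the chain rule applies to every
  summand.\<close>

lemma emp_risk_differentiable:
  fixes A :: "real^'q^'p"
  assumes "\<And>u. \<rho> differentiable (at u)"
  shows "emp_risk \<rho> n x y differentiable (at A)"
proof -
  have "(\<lambda>B. \<rho> (y i - trace (x i ** B))) differentiable (at A)" for i
  proof (rule differentiable_compose[OF assms])
    have "linear (\<lambda>B :: real^'q^'p. trace (x i ** B))"
      by (rule linearI)
        (simp_all add: trace_def matrix_matrix_mult_def sum_distrib_left sum.distrib
          distrib_left mult_ac)
    then have "(\<lambda>B :: real^'q^'p. trace (x i ** B)) differentiable (at A)"
      by (rule linear_imp_differentiable)
    then show "(\<lambda>B. y i - trace (x i ** B)) differentiable (at A)" by simp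
  qed
  then show ?thesis
    unfolding emp_risk_def[abs_def]
    by (intro differentiable_mult differentiable_const differentiable_sum) auto
qed

lemma convex_param_set: "convex (param_set \<eta> :: (real^'q^'p) set)"
proof -
  have "\<bar>u * a + v * b\<bar> \<le> \<eta>" if "\<bar>a\<bar> \<le> \<eta>" "\<bar>b\<bar> \<le> \<eta>" "0 \<le> u" "0 \<le> v" "u + v = 1" for a b u v :: real
  proof -
    have "\<bar>u * a + v * b\<bar> \<le> u * \<bar>a\<bar> + v * \<bar>b\<bar>"
      using that(3,4) abs_triangle_ineq[of "u * a" "v * b"] by (simp add: abs_mult)
    also have "\<dots> \<le> u * \<eta> + v * \<eta>"
      using that by (intro add_mono mult_left_mono)
    also have "\<dots> = \<eta>"
      using that(5) by (simp flip: distrib_right)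
    finally show ?thesis .
  qed
  then show ?thesis
    unfolding convex_def param_set_def infnorm_matrix_le_iff by simp
qed

text \<open>Compare \<open>x\<close> with the point a fraction \<open>t\<close> of the way towards
  \<open>z\<close>. Convexity of the penalty along the segment bounds its change by \<open>t\<close>
  times the total change; dividing by \<open>t\<close> and letting \<open>t\<close> decrease to 0
  differentiates only \<open>f\<close>.\<close>

lemma penalized_minimizer_variational_inequality:
  fixes f N :: "'a::real_normed_vector \<Rightarrow> real"
  assumes "convex C" "x \<in> C" "z \<in> C"
    and N: "\<And>t. 0 < t \<Longrightarrow> t < 1 \<Longrightarrow> N ((1 - t) *\<^sub>R x + t *\<^sub>R z) \<le> (1 - t) * N x + t * N z"
    and f: "(f has_derivative F) (at x)" and "0 \<le> lam"
    and min: "\<And>u. u \<in> C \<Longrightarrow> f x + lam * N x \<le> f u + lam * N u"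
  shows "lam * (N x - N z) \<le> F (z - x)"
proof -
  have "((\<lambda>t. (f (x + t *\<^sub>R (z - x)) - f x) / t) \<longlongrightarrow> F (z - x)) (at 0)"
    using has_derivative_directional[OF f, of "z - x"] by (simp add: DERIV_def)
  then have "((\<lambda>t. (f (x + t *\<^sub>R (z - x)) - f x) / t) \<longlongrightarrow> F (z - x)) (at_right 0)"
    by (rule tendsto_within_subset) simp
  moreover have "\<forall>\<^sub>F t in at_right 0. lam * (N x - N z) \<le> (f (x + t *\<^sub>R (z - x)) - f x) / t"
    unfolding eventually_at_right_field
  proof (intro exI[of _ 1] conjI allI impI)
    fix t :: real assume t: "0 < t" "t < 1"
    have e: "x + t *\<^sub>R (z - x) = (1 - t) *\<^sub>R x + t *\<^sub>R z"
      by (simp add: algebra_simps)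
    have "(1 - t) *\<^sub>R x + t *\<^sub>R z \<in> C"
      using assms(1-3) t by (intro convexD) auto
    from min[OF this] have "f x + lam * N x \<le> f (x + t *\<^sub>R (z - x)) + lam * N ((1 - t) *\<^sub>R x + t *\<^sub>R z)"
      by (simp add: e)
    also have "\<dots> \<le> f (x + t *\<^sub>R (z - x)) + lam * ((1 - t) * N x + t * N z)"
      using N[OF t] \<open>0 \<le> lam\<close> by (intro add_left_mono mult_left_mono)
    finally have "lam * (N x - N z) * t \<le> f (x + t *\<^sub>R (z - x)) - f x"
      by (simp add: algebra_simps)
    then show "lam * (N x - N z) \<le> (f (x + t *\<^sub>R (z - x)) - f x) / t"
      using t by (simp add: pos_le_divide_eq)
  qed simp
  ultimately show ?thesis
    by (rule tendsto_lowerbound) simp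
qed

theorem theorem3p1:
  fixes M :: "'w measure"
    and X :: "nat \<Rightarrow> 'w \<Rightarrow> real^'p^'q"
    and Y :: "nat \<Rightarrow> 'w \<Rightarrow> real"
    and \<rho> G :: "real \<Rightarrow> real"
    and n s :: nat
    and \<eta> L lam lam_eps lam_star \<delta> lam_under lam_over :: real
    and B Bhat :: "real^'q^'p"
    and P :: "nat \<Rightarrow> real^'p" and \<Lambda> :: "nat \<Rightarrow> real" and Q :: "nat \<Rightarrow> real^'q"
    and \<omega> :: 'w
  assumes "CARD('q) \<le> CARD('p)" and "0 < \<eta>" and "1 \<le> n"
    and "prob_space M"
    and "\<And>i. i \<in> {1..n} \<Longrightarrow> X i \<in> borel_measurable M"
    and "\<And>i. i \<in> {1..n} \<Longrightarrow> Y i \<in> borel_measurable M"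
    and "\<And>i w. i \<in> {1..n} \<Longrightarrow> w \<in> space M \<Longrightarrow> X i w \<in> design_set"
    and "\<And>B' :: real^'q^'p. integrable M (\<lambda>w. emp_risk \<rho> n (\<lambda>i. X i w) (\<lambda>i. Y i w) B')"
    and "convex_on UNIV \<rho>" and "\<And>x. \<rho> differentiable (at x)"
    and "\<And>x y. \<bar>\<rho> x - \<rho> y\<bar> \<le> L * \<bar>x - y\<bar>"
    and "strict_mono_on {0..} G" and "strictly_convex_on {0..} G" and "G 0 = 0"
    and margin: "\<And>B\<^sub>1 B\<^sub>2 :: real^'q^'p. B\<^sub>1 \<in> param_set \<eta> \<Longrightarrow> B\<^sub>2 \<in> param_set \<eta> \<Longrightarrow>
          risk M \<rho> n X Y B\<^sub>1 - risk M \<rho> n X Y B\<^sub>2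
            \<ge> trace (transpose (partials (risk M \<rho> n X Y) B\<^sub>2) ** (B\<^sub>1 - B\<^sub>2)) + G (norm (B\<^sub>1 - B\<^sub>2))"
    and "B \<in> param_set \<eta>" and "1 \<le> s" and "s \<le> CARD('q)"
    and "is_svd B P \<Lambda> Q"
    and "\<omega> \<in> space M"
    and "0 < lam_eps" and "0 < lam_star"
    and noise: "\<And>B' :: real^'q^'p. B' \<in> param_set \<eta> \<Longrightarrow>
          \<bar>trace (transpose (partials (emp_risk \<rho> n (\<lambda>i. X i \<omega>) (\<lambda>i. Y i \<omega>)) B'
                              - partials (risk M \<rho> n X Y) B') ** (B - B'))\<bar>
            \<le> lam_eps * Omega_under s P Q (B' - B) + lam_star"
    and "lam_eps < lam" and "0 \<le> \<delta>" and "\<delta> < 1"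
    and "lam_under = lam - lam_eps" and "lam_over = lam_eps + lam + \<delta> * lam_under"
    and "is_arg_min (\<lambda>B'. emp_risk \<rho> n (\<lambda>i. X i \<omega>) (\<lambda>i. Y i \<omega>) B' + lam * nuclear_norm B')
           (\<lambda>B'. B' \<in> param_set \<eta>) Bhat"
  shows "ereal (\<delta> * lam_under * Omega_plus s P Q (Bhat - B)
                + \<delta> * lam_under * Omega_minus s P Q (Bhat - B)
                + risk M \<rho> n X Y Bhat - risk M \<rho> n X Y B)
         \<le> convex_conjugate G (3 * lam_over * sqrt (real s))
            + ereal (2 * lam * nuclear_norm (B_minus s P \<Lambda> Q) + lam_star)"
proof -
  let ?Rn = "emp_risk \<rho> n (\<lambda>i. X i \<omega>) (\<lambda>i. Y i \<omega>)" and ?R = "risk M \<rho> n X Y"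
  let ?D = "Bhat - B" and ?Bm = "B_minus s P \<Lambda> Q"
  let ?plus = "Omega_plus s P Q ?D" and ?minus = "Omega_minus s P Q ?D"
  note card = \<open>CARD('q) \<le> CARD('p)\<close>
  have lam: "0 < lam" using \<open>0 < lam_eps\<close> \<open>lam_eps < lam\<close> by simp
  have Bhat: "Bhat \<in> param_set \<eta>"
    and min: "\<And>u. u \<in> param_set \<eta> \<Longrightarrow>
      ?Rn Bhat + lam * nuclear_norm Bhat \<le> ?Rn u + lam * nuclear_norm u"
    using \<open>is_arg_min _ _ Bhat\<close> by (auto simp: is_arg_min_linorder)
  obtain F where F: "(?Rn has_derivative F) (at Bhat)"
    using emp_risk_differentiable[of \<rho>] \<open>\<And>x. \<rho> differentiable (at x)\<close>
    unfolding differentiable_def by blast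
  have "lam * (nuclear_norm Bhat - nuclear_norm B) \<le> F (B - Bhat)"
    using convex_param_set Bhat \<open>B \<in> param_set \<eta>\<close> _ F _ min
    by (rule penalized_minimizer_variational_inequality)
      (use lam in \<open>auto intro!: nuclear_norm_convex_comb[OF card]\<close>)
  then have "lam * (nuclear_norm Bhat - nuclear_norm B) \<le> partials ?Rn Bhat \<bullet> (B - Bhat)"
    by (simp add: partials_inner[OF F])
  \<comment> \<open>The noise bound is taken at \<open>Bhat\<close>, where the optimality condition
    holds.\<close>
  moreover have "(partials ?Rn Bhat - partials ?R Bhat) \<bullet> (B - Bhat)
      \<le> lam_eps * Omega_under s P Q ?D + lam_star"
    using noise[OF Bhat] by (simp add: inner_matrix_trace)
  \<comment> \<open>The margin condition is used with base point \<open>Bhat\<close>, so that the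
    gradient of the risk cancels against the one in the noise bound. The excess risk keeps
    coefficient 1, which makes the inequality sharp.\<close>
  moreover have "partials ?R Bhat \<bullet> (B - Bhat) + G (norm ?D) \<le> ?R B - ?R Bhat"
    using margin[OF \<open>B \<in> param_set \<eta>\<close> Bhat] by (simp add: inner_matrix_trace norm_minus_commute)
  ultimately have basic: "?R Bhat - ?R B + G (norm ?D)
      \<le> lam_eps * (?plus + ?minus) + lam_star + lam * (nuclear_norm B - nuclear_norm Bhat)"
    by (simp add: inner_diff_left Omega_under_def algebra_simps)
  have "nuclear_norm B - nuclear_norm Bhat \<le> ?plus - ?minus + 2 * nuclear_norm ?Bm"
    using nuclear_norm_triangle_property[OF card \<open>is_svd B P \<Lambda> Q\<close> \<open>s \<le> CARD('q)\<close>, of ?D] by simp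
  then have "lam * (nuclear_norm B - nuclear_norm Bhat)
      \<le> lam * (?plus - ?minus + 2 * nuclear_norm ?Bm)"
    using lam by (intro mult_left_mono) auto
  \<comment> \<open>Collecting terms, the coefficient of \<open>?plus\<close> is
    \<open>lam_eps + lam + \<delta> * lam_under\<close>, which is \<open>lam_over\<close>, and that
    of \<open>?minus\<close> is \<open>lam_eps - lam + \<delta> * lam_under\<close>, which is
    \<open>- (1 - \<delta>) * lam_under\<close>.\<close>
  with basic have "\<delta> * lam_under * ?plus + \<delta> * lam_under * ?minus + ?R Bhat - ?R B
      \<le> lam_over * ?plus - (1 - \<delta>) * lam_under * ?minus - G (norm ?D)
        + (2 * lam * nuclear_norm ?Bm + lam_star)"
    unfolding \<open>lam_over = _\<close> \<open>lam_under = _\<close> by (simp add: algebra_simps)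
  moreover have "0 \<le> (1 - \<delta>) * lam_under * ?minus"
    using nuclear_norm_nonneg[OF card] \<open>\<delta> < 1\<close> \<open>lam_eps < lam\<close> \<open>lam_under = _\<close>
    by (simp add: Omega_minus_def)
  moreover have "lam_over * ?plus \<le> lam_over * (3 * sqrt (real s) * norm ?D)"
  proof (rule mult_left_mono)
    have "{1..s} \<subseteq> {1..CARD('q)}" using \<open>s \<le> CARD('q)\<close> by auto
    then show "?plus \<le> 3 * sqrt (real s) * norm ?D"
      using \<open>is_svd B P \<Lambda> Q\<close> unfolding is_svd_def
      by (intro Omega_plus_le) (auto intro: orthonormal_family_subset)
    show "0 \<le> lam_over"
      using \<open>0 \<le> \<delta>\<close> \<open>0 < lam_eps\<close> \<open>lam_eps < lam\<close> \<open>lam_over = _\<close> \<open>lam_under = _\<close> by simp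
  qed
  ultimately have "\<delta> * lam_under * ?plus + \<delta> * lam_under * ?minus + ?R Bhat - ?R B
      \<le> (norm ?D * (3 * lam_over * sqrt (real s)) - G (norm ?D))
        + (2 * lam * nuclear_norm ?Bm + lam_star)"
    by (simp add: algebra_simps)
  then have "ereal (\<delta> * lam_under * ?plus + \<delta> * lam_under * ?minus + ?R Bhat - ?R B)
      \<le> ereal (norm ?D * (3 * lam_over * sqrt (real s)) - G (norm ?D))
        + ereal (2 * lam * nuclear_norm ?Bm + lam_star)"
    by simp
  \<comment> \<open>Fenchel-Young: \<open>norm ?D\<close> is one admissible \<open>u\<close> in the
    supremum. The estimate is made in the extended reals and so covers an infinite
    conjugate.\<close>
  also have "\<dots> \<le> convex_conjugate G (3 * lam_over * sqrt (real s))
        + ereal (2 * lam * nuclear_norm ?Bm + lam_star)"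
    unfolding convex_conjugate_def by (intro add_right_mono SUP_upper) simp
  finally show ?thesis .
qed

end
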